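(* For every integer $n\ge 0$ and every integer $k\ge 1$, one has, as polynomials in $x$ (i.e. for all $x\in\mathbb{C}_p$), \[ D_n^{(k)}(x)=B_n^{(n+k+1)}(x+1)=\sum_{l=0}^{n}\binom{n}{l}B_l^{(n+k+1)}\,(x+1)^{n-l}. \]
   Context: Fix a prime $p$. $\mathbb{Z}_p$ is the ring of $p$-adic integers and $\mathbb{C}_p$ is the completion of an algebraic closure of $\mathbb{Q}_p$. For a uniformly differentiable function $f$ on $\mathbb{Z}_p$ (with values in $\mathbb{C}_p$), the $p$-adic invariant (Volkenborn) integral is $\int_{\mathbb{Z}_p}f(x)\,d\mu(x)=\lim_{N\to\infty}\frac{1}{p^N}\sum_{x=0}^{p^N-1}f(x)$. Write $(y)_n=y(y-1)\cdots(y-n+1)$ (with $(y)_0=1$). The Daehee polynomials (of the first kind) of order $k$ are defined by the $k$-fold iterated integral \[ D_n^{(k)}(x)=\int_{\mathbb{Z}_p}\cdots\int_{\mathbb{Z}_p}(x_1+\cdots+x_k+x)_n\,d\mu(x_1)\cdots d\mu(x_k). \] The Bernoulli polynomials of order $\alpha\in\mathbb{N}$ are defined by $\left(\frac{t}{e^t-1}\right)^{\alpha}e^{xt}=\sum_{n\ge0}B_n^{(\alpha)}(x)\frac{t^n}{n!}$, and $B_n^{(\alpha)}=B_n^{(\alpha)}(0)$ are the Bernoulli numbers of order $\alpha$. *)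

theory Defs
  imports "HOL-Analysis.Analysis" "HOL-Computational_Algebra.Computational_Algebra"
begin

section \<open>The field of p-adic complex numbers\<close>

definition padic_abs_rat :: "nat \<Rightarrow> rat \<Rightarrow> real" where
  "padic_abs_rat p q =
     (if q = 0 then 0
      else real p powi
        (int (multiplicity (int p) (snd (quotient_of q)))
          - int (multiplicity (int p) (fst (quotient_of q)))))"

text \<open>
  As a type cannot depend on the prime p, the field of p-adic complex numbers is
  not constructed but described by a predicate on a type that carries a field
  structure and a complete metric. The absolute value is the distance from 0
  (the class \<open>real_normed_field\<close> is of no use here, since it forces the
  absolute value to be archimedean).
\<close>

definition vabs :: "'a::{zero,metric_space} \<Rightarrow> real" where
  "vabs x = dist x 0"

text \<open>
  Inside a complete valued field whose absolute value extends the p-adic one on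
  the rationals, the completion of the rationals is their closure, and its
  algebraic closure consists of the elements algebraic over it (provided that
  these form an algebraically closed field, see \<open>is_C_p\<close> below).
\<close>

definition Q_p :: "'a::{field_char_0,metric_space} set" where
  "Q_p = closure (range of_rat)"

definition Z_p :: "'a::{field_char_0,metric_space} set" where
  "Z_p = {x \<in> Q_p. vabs x \<le> 1}"

definition Q_p_bar :: "'a::{field_char_0,metric_space} set" where
  "Q_p_bar = {x. \<exists>f::'a poly. f \<noteq> 0 \<and> (\<forall>i. coeff f i \<in> Q_p) \<and> poly f x = 0}"

text \<open>
  \<open>is_C_p p TYPE('a)\<close>: the type \<open>'a\<close> is the completion of an algebraic closure of
  the field of p-adic numbers. This determines \<open>'a\<close> up to isometric isomorphism.
\<close>

definition is_C_p :: "nat \<Rightarrow> 'a::{field_char_0,complete_space} itself \<Rightarrow> bool" where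
  "is_C_p p T \<longleftrightarrow>
     \<comment> \<open>the metric comes from a non-archimedean absolute value extending the p-adic one\<close>
     (\<forall>x y::'a. dist x y = vabs (x - y)) \<and>
     (\<forall>x y::'a. vabs (x * y) = vabs x * vabs y) \<and>
     (\<forall>x y::'a. vabs (x + y) \<le> max (vabs x) (vabs y)) \<and>
     (\<forall>q. vabs (of_rat q :: 'a) = padic_abs_rat p q) \<and>
     \<comment> \<open>\<open>Q_p_bar\<close> is algebraically closed, hence an algebraic closure of \<open>Q_p\<close>\<close>
     (\<forall>f::'a poly. degree f > 0 \<and> (\<forall>i. coeff f i \<in> Q_p_bar) \<longrightarrow> (\<exists>x\<in>Q_p_bar. poly f x = 0)) \<and>
     \<comment> \<open>\<open>'a\<close>, which is complete by its sort, is the completion of \<open>Q_p_bar\<close>\<close>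
     closure (Q_p_bar :: 'a set) = UNIV"


section \<open>The Volkenborn integral\<close>

text \<open>
  Uniform (also called strict) differentiability on \<open>Z_p\<close>: at each point a of \<open>Z_p\<close>, the
  difference quotient (f x - f y) / (x - y) has a limit as (x, y) tends to (a, a) with
  x and y distinct elements of \<open>Z_p\<close>.
\<close>

definition uniformly_differentiable ::
    "('a::{field_char_0,metric_space} \<Rightarrow> 'a) \<Rightarrow> bool" where
  "uniformly_differentiable f \<longleftrightarrow>
     (\<forall>a\<in>Z_p. \<exists>d. ((\<lambda>(x, y). (f x - f y) / (x - y)) \<longlongrightarrow> d)
        (at (a, a) within {(x, y). x \<in> Z_p \<and> y \<in> Z_p \<and> x \<noteq> y}))"

definition volkenborn ::
    "nat \<Rightarrow> ('a::{field_char_0,metric_space} \<Rightarrow> 'a) \<Rightarrow> 'a" where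
  "volkenborn p f =
     (if uniformly_differentiable f
      then lim (\<lambda>N. 1 / of_nat (p ^ N) * (\<Sum>x = 0..<p ^ N. f (of_nat x)))
      else undefined)"

text \<open>
  The iterated integral of F over the lists [x1, ..., xk]: the innermost integration is
  with respect to x1, the outermost with respect to xk.
\<close>

primrec iterated_volkenborn ::
    "nat \<Rightarrow> nat \<Rightarrow> ('a::{field_char_0,metric_space} list \<Rightarrow> 'a) \<Rightarrow> 'a" where
  "iterated_volkenborn p 0 F = F []"
| "iterated_volkenborn p (Suc k) F =
     volkenborn p (\<lambda>y. iterated_volkenborn p k (\<lambda>xs. F (xs @ [y])))"


section \<open>Daehee and Bernoulli polynomials of higher order\<close>

definition falling_factorial :: "'a::comm_ring_1 \<Rightarrow> nat \<Rightarrow> 'a" where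
  "falling_factorial y n = (\<Prod>i<n. y - of_nat i)"

definition daehee_poly ::
    "nat \<Rightarrow> nat \<Rightarrow> nat \<Rightarrow> 'a::{field_char_0,metric_space} \<Rightarrow> 'a" where
  "daehee_poly p k n x =
     iterated_volkenborn p k (\<lambda>xs. falling_factorial (sum_list xs + x) n)"

definition bernoulli_poly :: "nat \<Rightarrow> nat \<Rightarrow> 'a::field_char_0 \<Rightarrow> 'a" where
  "bernoulli_poly \<alpha> n x =
     fact n * fps_nth ((fps_X / (fps_exp 1 - 1)) ^ \<alpha> * fps_exp x) n"

definition bernoulli_num :: "nat \<Rightarrow> nat \<Rightarrow> 'a::field_char_0" where
  "bernoulli_num \<alpha> n = bernoulli_poly \<alpha> n 0"

end

theory Submission
  imports Defs
begin

text \<open>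
  Since the sum of \<open>x gchoose j\<close> over \<open>x < M\<close> is \<open>M * (M - 1 gchoose j) / (j + 1)\<close> and
  \<open>p ^ N\<close> tends to 0, the Volkenborn integral of \<open>y gchoose j\<close> is \<open>(-1) ^ j / (j + 1)\<close>, the
  j-th coefficient of \<open>log (1 + t) / t\<close>. Each integration therefore multiplies the exponential
  generating function \<open>(1 + t) ^ x\<close> of the falling factorials by \<open>log (1 + t) / t\<close>. The Daehee
  polynomial is thus n! times the residue of \<open>(log (1 + t) / t) ^ k * (1 + t) ^ x / t ^ (n + 1) dt\<close>,
  and the substitution \<open>t = e ^ u - 1\<close> turns this residue into the coefficient of \<open>u ^ n\<close> in
  \<open>(u / (e ^ u - 1)) ^ (n + k + 1) * e ^ ((x + 1) u)\<close>.
\<close>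

section \<open>The Volkenborn integral of a polynomial\<close>

locale padic_complex_field =
  fixes p :: nat and T :: "'a::{field_char_0,complete_space} itself"
  assumes p_prime: "prime p" and C_p: "is_C_p p T"
begin

lemma dist_eq_vabs: "dist x y = vabs (x - y)" for x y :: 'a
  using C_p unfolding is_C_p_def by blast

lemma vabs_mult: "vabs (x * y) = vabs x * vabs y" for x y :: 'a
  using C_p unfolding is_C_p_def by blast

lemma vabs_add_le: "vabs (x + y) \<le> max (vabs x) (vabs y)" for x y :: 'a
  using C_p unfolding is_C_p_def by blast

lemma vabs_of_rat: "vabs (of_rat q :: 'a) = padic_abs_rat p q"
  using C_p unfolding is_C_p_def by blast

lemma vabs_nonneg [simp]: "vabs (x :: 'a) \<ge> 0"
  by (simp add: vabs_def)

lemma vabs_add_le_sum: "vabs (x + y) \<le> vabs x + vabs y" for x y :: 'a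
  using vabs_add_le[of x y] vabs_nonneg[of x] vabs_nonneg[of y] by linarith

text \<open>The sort of \<open>'a\<close> provides a field and a complete metric but no link between
  them; this reduction to real limits lets the laws of \<open>vabs\<close> yield continuity of
  addition and multiplication.\<close>

lemma tendsto_iff_vabs:
  "(f \<longlongrightarrow> l) F \<longleftrightarrow> ((\<lambda>x. vabs (f x - l)) \<longlongrightarrow> 0) F" for f :: "'b \<Rightarrow> 'a"
  by (subst tendsto_dist_iff) (simp add: dist_eq_vabs)

lemma padic_tendsto_add:
  fixes f g :: "'b \<Rightarrow> 'a"
  assumes "(f \<longlongrightarrow> l) F" "(g \<longlongrightarrow> m) F"
  shows "((\<lambda>x. f x + g x) \<longlongrightarrow> l + m) F"
proof -
  have lim: "((\<lambda>x. vabs (f x - l) + vabs (g x - m)) \<longlongrightarrow> 0) F"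
    using tendsto_add[OF assms[unfolded tendsto_iff_vabs]] by simp
  have "vabs (f x + g x - (l + m)) \<le> vabs (f x - l) + vabs (g x - m)" for x
    using vabs_add_le_sum[of "f x - l" "g x - m"] by (simp add: algebra_simps)
  then show ?thesis
    unfolding tendsto_iff_vabs by (intro tendsto_sandwich[OF _ _ tendsto_const lim]) auto
qed

lemma padic_tendsto_mult:
  fixes f g :: "'b \<Rightarrow> 'a"
  assumes "(f \<longlongrightarrow> l) F" "(g \<longlongrightarrow> m) F"
  shows "((\<lambda>x. f x * g x) \<longlongrightarrow> l * m) F"
proof -
  let ?u = "\<lambda>x. vabs (f x - l)" and ?v = "\<lambda>x. vabs (g x - m)"
  have u: "(?u \<longlongrightarrow> 0) F" and v: "(?v \<longlongrightarrow> 0) F"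
    using assms by (simp_all add: tendsto_iff_vabs)
  have "((\<lambda>x. ?u x * ?v x + (vabs l * ?v x + ?u x * vabs m)) \<longlongrightarrow>
      0 * 0 + (vabs l * 0 + 0 * vabs m)) F"
    by (intro tendsto_intros u v)
  then have lim: "((\<lambda>x. ?u x * ?v x + (vabs l * ?v x + ?u x * vabs m)) \<longlongrightarrow> 0) F"
    by simp
  have "vabs (f x * g x - l * m) \<le> ?u x * ?v x + (vabs l * ?v x + ?u x * vabs m)" for x
  proof -
    have "f x * g x - l * m = (f x - l) * (g x - m) + (l * (g x - m) + (f x - l) * m)"
      by (simp add: algebra_simps)
    then have "vabs (f x * g x - l * m) \<le>
        vabs ((f x - l) * (g x - m)) + vabs (l * (g x - m) + (f x - l) * m)"
      using vabs_add_le_sum by metis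
    also have "\<dots> \<le> vabs ((f x - l) * (g x - m)) + (vabs (l * (g x - m)) + vabs ((f x - l) * m))"
      using vabs_add_le_sum by (intro add_left_mono)
    finally show ?thesis
      by (simp add: vabs_mult)
  qed
  then show ?thesis
    unfolding tendsto_iff_vabs by (intro tendsto_sandwich[OF _ _ tendsto_const lim]) auto
qed

lemma padic_tendsto_poly:
  fixes f :: "'b \<Rightarrow> 'a"
  assumes "(f \<longlongrightarrow> l) F"
  shows "((\<lambda>x. poly P (f x)) \<longlongrightarrow> poly P l) F"
  by (induction P) (auto intro!: padic_tendsto_add padic_tendsto_mult assms)

text \<open>This unlocks the limit in \<open>volkenborn\<close>, which is \<open>undefined\<close>
  for other integrands.\<close>

lemma uniformly_differentiable_poly: "uniformly_differentiable (poly (P :: 'a poly))"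
  unfolding uniformly_differentiable_def
proof
  fix a :: 'a
  define F where "F = at (a, a) within {(x, y). x \<in> Z_p \<and> y \<in> Z_p \<and> x \<noteq> y}"
  have "((\<lambda>z. z) \<longlongrightarrow> (a, a)) F"
    unfolding F_def by (rule tendsto_ident_at)
  then have fst: "(fst \<longlongrightarrow> a) F" and snd: "(snd \<longlongrightarrow> a) F"
    using tendsto_fst tendsto_snd by fastforce+
  have neq: "\<forall>\<^sub>F z in F. fst z \<noteq> snd z"
    unfolding F_def eventually_at_filter by (auto intro: always_eventually)
  have "\<exists>d. ((\<lambda>z. (poly P (fst z) - poly P (snd z)) / (fst z - snd z)) \<longlongrightarrow> d) F"
  proof (induction P)
    case 0
    then show ?case by (auto intro: tendsto_const)
  next
    case (pCons c P)
    then obtain d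
      where d: "((\<lambda>z. (poly P (fst z) - poly P (snd z)) / (fst z - snd z)) \<longlongrightarrow> d) F"
      by blast
    \<comment> \<open>A product rule for difference quotients: x P(x) - y P(y) = (x - y) P(x) + y
      (P(x) - P(y)), and the constant c cancels.\<close>
    have "((\<lambda>z. poly P (fst z) + snd z * ((poly P (fst z) - poly P (snd z)) / (fst z - snd z)))
        \<longlongrightarrow> poly P a + a * d) F"
      by (intro padic_tendsto_add padic_tendsto_mult padic_tendsto_poly fst snd d)
    moreover have "\<forall>\<^sub>F z in F.
        poly P (fst z) + snd z * ((poly P (fst z) - poly P (snd z)) / (fst z - snd z)) =
        (poly (pCons c P) (fst z) - poly (pCons c P) (snd z)) / (fst z - snd z)"
      using neq by eventually_elim (simp add: field_simps)
    ultimately show ?case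
      by (intro exI) (rule Lim_transform_eventually)
  qed
  then show "\<exists>d. ((\<lambda>(x, y). (poly P x - poly P y) / (x - y)) \<longlongrightarrow> d)
      (at (a, a) within {(x, y). x \<in> Z_p \<and> y \<in> Z_p \<and> x \<noteq> y})"
    by (simp add: F_def case_prod_unfold)
qed

lemma prime_power_tendsto_0: "(\<lambda>N. of_nat (p ^ N) :: 'a) \<longlonglongrightarrow> 0"
proof -
  have p: "p > 1" "prime (int p)"
    using p_prime prime_gt_1_nat by auto
  have "vabs (of_nat (p ^ N) :: 'a) = (1 / real p) ^ N" for N
  proof -
    have quot: "quotient_of (of_nat (p ^ N)) = (int (p ^ N), 1)"
      using quotient_of_int[of "int (p ^ N)"] by (simp add: Rat.of_int_def)
    have "multiplicity (int p) (int p ^ N) = N"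
      using p by (intro multiplicity_same_power) auto
    then show ?thesis
      using vabs_of_rat[of "of_nat (p ^ N)"] p quot
      by (simp add: of_rat_power padic_abs_rat_def power_int_minus power_one_over field_simps)
  qed
  moreover have "(\<lambda>N. (1 / real p) ^ N) \<longlonglongrightarrow> 0"
    using p by (intro LIMSEQ_realpow_zero) auto
  ultimately show ?thesis
    by (simp add: tendsto_iff_vabs)
qed

text \<open>At M = p^N the factor M cancels the normalisation 1/p^N, so the averages are the values
  of Q at p^N, and p^N tends to 0.\<close>

lemma volkenborn_poly:
  fixes P Q :: "'a poly"
  assumes "\<And>M :: nat. (\<Sum>x<M. poly P (of_nat x)) = of_nat M * poly Q (of_nat M)"
  shows "volkenborn p (poly P) = poly Q 0"
proof -
  have "p > 0"
    using p_prime prime_gt_0_nat by blast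
  then have "1 / of_nat (p ^ N) * (\<Sum>x = 0..<p ^ N. poly P (of_nat x)) = poly Q (of_nat (p ^ N))" for N
    using assms[of "p ^ N"] by (simp add: atLeast0LessThan)
  moreover have "(\<lambda>N. poly Q (of_nat (p ^ N))) \<longlonglongrightarrow> poly Q 0"
    by (intro padic_tendsto_poly prime_power_tendsto_0)
  ultimately show ?thesis
    by (simp add: volkenborn_def uniformly_differentiable_poly limI)
qed

end

section \<open>Integrals of binomial coefficients\<close>

lemma poly_gbinomial_ex: "\<exists>P :: 'a::field_char_0 poly. \<forall>y. poly P y = (y + c) gchoose j"
proof
  show "\<forall>y. poly (smult (1 / fact j) (\<Prod>i=0..<j. [:c - of_nat i, 1:])) y = (y + c) gchoose j"
    by (simp add: gbinomial_prod_rev poly_prod algebra_simps)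
qed

text \<open>Pascal's rule telescopes the sum to \<open>of_nat M gchoose Suc j\<close>; absorption
  then extracts the factor M that \<open>volkenborn_poly\<close> requires.\<close>

lemma sum_gbinomial_of_nat:
  "(\<Sum>x<M. (of_nat x :: 'a::field_char_0) gchoose j) =
    of_nat M * ((of_nat M - 1) gchoose j) / of_nat (Suc j)"
proof -
  have "(\<Sum>x<M. (of_nat x :: 'a) gchoose j) = of_nat M gchoose Suc j"
  proof (induction M)
    case (Suc M)
    then show ?case
      using gbinomial_Suc_Suc[of "of_nat M :: 'a" j] by (simp add: add_ac)
  qed simp
  also have "\<dots> = of_nat M * ((of_nat M - 1) gchoose j) / of_nat (Suc j)"
    using gbinomial_absorption[of j "of_nat M :: 'a"]
    by (subst nonzero_eq_divide_eq) (simp_all add: mult.commute del: of_nat_Suc)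
  finally show ?thesis .
qed

context padic_complex_field
begin

lemma volkenborn_gbinomial_sum:
  fixes c :: "nat \<Rightarrow> 'a"
  shows "volkenborn p (\<lambda>y. \<Sum>j\<le>n. c j * (y gchoose j)) = (\<Sum>j\<le>n. c j * ((-1) ^ j / of_nat (Suc j)))"
proof -
  obtain B :: "nat \<Rightarrow> 'a poly" where B: "\<And>j y. poly (B j) y = y gchoose j"
    using poly_gbinomial_ex[of 0] by (metis add.right_neutral)
  obtain C :: "nat \<Rightarrow> 'a poly" where C: "\<And>j y. poly (C j) y = (y - 1) gchoose j"
    using poly_gbinomial_ex[of "-1"] by (metis diff_conv_add_uminus)
  let ?P = "\<Sum>j\<le>n. smult (c j) (B j)" and ?Q = "\<Sum>j\<le>n. smult (c j / of_nat (Suc j)) (C j)"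
  have "(\<Sum>x<M. poly ?P (of_nat x)) = of_nat M * poly ?Q (of_nat M)" for M
  proof -
    have "(\<Sum>x<M. poly ?P (of_nat x)) = (\<Sum>j\<le>n. c j * (\<Sum>x<M. of_nat x gchoose j))"
      by (simp add: poly_sum B sum_distrib_left sum.swap[of _ "{..n}"])
    then show ?thesis
      by (simp add: poly_sum C sum_gbinomial_of_nat sum_distrib_left mult_ac del: of_nat_Suc)
  qed
  then have "volkenborn p (poly ?P) = poly ?Q 0"
    by (rule volkenborn_poly)
  moreover have "poly ?P = (\<lambda>y. \<Sum>j\<le>n. c j * (y gchoose j))"
    by (simp add: fun_eq_iff poly_sum B)
  \<comment> \<open>This is the value of \<open>C j\<close> at 0, the source of the signs in
    \<open>daehee_fps\<close>.\<close>
  moreover have "((-1 :: 'a) gchoose j) = (-1) ^ j" for j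
    using gbinomial_minus[of "1 :: 'a" j] by (simp add: flip: binomial_gbinomial of_nat_diff)
  ultimately show ?thesis
    by (simp add: poly_sum C del: of_nat_Suc)
qed

end

section \<open>The generating function of the Daehee polynomials\<close>

text \<open>The series log(1 + t)/t, given by its coefficients so that they match the integrals of
  \<open>y gchoose j\<close> directly.\<close>

definition daehee_fps :: "'a::field_char_0 fps" where
  "daehee_fps = Abs_fps (\<lambda>j. (-1) ^ j / of_nat (Suc j))"

lemma daehee_fps_nth [simp]: "fps_nth daehee_fps j = (-1) ^ j / of_nat (Suc j)"
  by (simp add: daehee_fps_def)

lemma fps_X_mult_daehee_fps: "fps_X * daehee_fps = fps_ln (1 :: 'a::field_char_0)"
  by (rule fps_ext) (auto simp: fps_ln_def gr0_conv_Suc)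

text \<open>Induction on k with x arbitrary: the outermost variable y is absorbed into the argument,
  which becomes y + x.\<close>

lemma (in padic_complex_field) daehee_poly_eq_coeff:
  "daehee_poly p k n (x :: 'a) = fact n * fps_nth (daehee_fps ^ k * fps_binomial x) n"
proof (induction k arbitrary: x)
  case 0
  show ?case
    by (simp add: daehee_poly_def falling_factorial_def gbinomial_prod_rev atLeast0LessThan)
next
  case (Suc k)
  \<comment> \<open>Since (1 + t)^(y + x) = (1 + t)^y (1 + t)^x, these are the coefficients of the
    inner integral as a combination of the \<open>y gchoose j\<close>.\<close>
  define c where "c j = fact n * fps_nth (daehee_fps ^ k * fps_binomial x) (n - j)" for j
  have "daehee_poly p (Suc k) n x = volkenborn p (\<lambda>y. daehee_poly p k n (y + x))"
    by (simp add: daehee_poly_def add.assoc)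
  also have "(\<lambda>y. daehee_poly p k n (y + x)) = (\<lambda>y. \<Sum>j\<le>n. c j * (y gchoose j))"
  proof
    fix y
    have "daehee_poly p k n (y + x) =
        fact n * fps_nth (fps_binomial y * (daehee_fps ^ k * fps_binomial x)) n"
      by (simp add: Suc.IH fps_binomial_add_mult mult.left_commute)
    then show "daehee_poly p k n (y + x) = (\<Sum>j\<le>n. c j * (y gchoose j))"
      unfolding fps_mult_nth[of "fps_binomial y"]
      by (simp add: c_def sum_distrib_left atLeast0AtMost mult.assoc mult.left_commute mult.commute[of "y gchoose _"])
  qed
  also have "volkenborn p \<dots> = (\<Sum>j\<le>n. c j * ((-1) ^ j / of_nat (Suc j)))"
    by (rule volkenborn_gbinomial_sum)
  also have "\<dots> = fact n * fps_nth (daehee_fps * (daehee_fps ^ k * fps_binomial x)) n"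
    unfolding fps_mult_nth[of daehee_fps] sum_distrib_left atLeast0AtMost
    by (intro sum.cong) (simp_all add: c_def mult_ac del: of_nat_Suc)
  finally show ?case
    by (simp add: mult.assoc)
qed

section \<open>Change of variables\<close>

lemma fps_deriv_mult_power_nth:
  fixes E W :: "'a::field_char_0 fps"
  assumes EW: "E * W = fps_X" and E0: "fps_nth E 0 = 0"
  shows "fps_nth (fps_deriv E * W ^ Suc r) r = (if r = 0 then 1 else 0)"
proof (cases r)
  case 0
  have "fps_nth E 1 * fps_nth W 0 = 1"
    using arg_cong[OF EW, of "\<lambda>f. fps_nth f 1"] E0 by (simp add: fps_mult_nth)
  then show ?thesis
    using 0 by simp
next
  case (Suc s)
  have "fps_deriv E * W = 1 - E * fps_deriv W"
    using arg_cong[OF EW, of fps_deriv] by (simp add: algebra_simps)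
  then have "fps_deriv E * W ^ Suc r = (1 - E * fps_deriv W) * W ^ r"
    by (simp flip: mult.assoc)
  also have "\<dots> = W ^ r - E * W * (fps_deriv W * W ^ s)"
    by (simp add: Suc algebra_simps)
  finally have eq: "fps_deriv E * W ^ Suc r = W ^ r - fps_X * (fps_deriv W * W ^ s)"
    by (simp only: EW)
  \<comment> \<open>After multiplication by r, the right side of \<open>eq\<close> is r W^r - u
    (W^r)'. Its r-th coefficient vanishes because u d/du multiplies that coefficient of W^r by
    r.\<close>
  have "fps_deriv (W ^ r) = fps_const (of_nat r) * (fps_deriv W * W ^ s)"
    by (simp add: fps_deriv_power Suc mult.assoc del: power_Suc of_nat_Suc)
  then have "fps_const (of_nat r) * (fps_deriv E * W ^ Suc r) =
      fps_const (of_nat r) * W ^ r - fps_X * fps_deriv (W ^ r)"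
    by (simp only: eq right_diff_distrib mult.left_commute)
  then have "fps_nth (fps_const (of_nat r) * (fps_deriv E * W ^ Suc r)) r =
      fps_nth (fps_const (of_nat r) * W ^ r - fps_X * fps_deriv (W ^ r)) r"
    by simp
  also have "\<dots> = 0"
    by (simp add: Suc del: of_nat_Suc power_Suc)
  finally show ?thesis
    using Suc by (simp only: fps_mult_left_const_nth mult_eq_0_iff of_nat_eq_0_iff) simp
qed

text \<open>
  This is the invariance of the residue of \<open>G(t) dt / t^(n+1)\<close> under \<open>t = E(u)\<close>, with the
  unit \<open>W = u / E(u)\<close> clearing the denominators.
\<close>

lemma fps_nth_change_of_variable:
  fixes E W G :: "'a::field_char_0 fps"
  assumes EW: "E * W = fps_X" and E0: "fps_nth E 0 = 0"
  shows "fps_nth (fps_compose G E * (fps_deriv E * W ^ Suc n)) n = fps_nth G n"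
proof -
  define H where "H = fps_deriv E * W ^ Suc n"
  \<comment> \<open>The case G = t^m: m factors W turn E^m into u^m, which shifts the coefficient
    index to r = n - m.\<close>
  have monomial: "fps_nth (E ^ m * H) n = (if m = n then 1 else 0)" if "m \<le> n" for m
  proof -
    have "W ^ Suc n = W ^ m * W ^ Suc (n - m)"
      using that by (simp flip: power_add)
    then have "E ^ m * H = (E * W) ^ m * (fps_deriv E * W ^ Suc (n - m))"
      unfolding H_def power_mult_distrib by (simp only: mult_ac)
    then have "fps_nth (E ^ m * H) n = fps_nth (fps_deriv E * W ^ Suc (n - m)) (n - m)"
      using that by (simp add: EW fps_X_power_mult_nth)
    then show ?thesis
      using that by (simp only: fps_deriv_mult_power_nth[OF EW E0]) auto
  qed
  \<comment> \<open>As E^m has no terms below u^m, the sum over m may run to n for every i, which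
    makes the two sums interchangeable.\<close>
  have comp: "fps_nth (fps_compose G E) i = (\<Sum>m=0..n. fps_nth G m * fps_nth (E ^ m) i)"
    if "i \<le> n" for i
    unfolding fps_compose_nth using that
    by (intro sum.mono_neutral_left) (auto simp: startsby_zero_power_prefix[OF E0])
  have "fps_nth (fps_compose G E * H) n =
      (\<Sum>i=0..n. \<Sum>m=0..n. fps_nth G m * (fps_nth (E ^ m) i * fps_nth H (n - i)))"
    by (simp add: fps_mult_nth comp sum_distrib_right mult.assoc)
  also have "\<dots> = (\<Sum>m=0..n. fps_nth G m * fps_nth (E ^ m * H) n)"
    by (subst sum.swap) (simp add: fps_mult_nth sum_distrib_left)
  also have "\<dots> = fps_nth G n"
    by (simp add: monomial if_distrib[of "(*) _"] cong: if_cong)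
  finally show ?thesis
    by (simp add: H_def)
qed

section \<open>The substitution t = e^u - 1\<close>

lemma fps_exp_minus_1_mult:
  "(fps_exp 1 - 1) * (fps_X / (fps_exp 1 - 1)) = (fps_X :: 'a::field_char_0 fps)"
proof -
  \<comment> \<open>Order exactly 1 means that the divisor divides \<open>fps_X\<close>, so the
    quotient is exact.\<close>
  have "subdegree (fps_exp 1 - 1 :: 'a fps) = 1"
    by (intro subdegreeI) auto
  then show ?thesis
    by (intro dvd_mult_div_cancel) (auto simp: fps_dvd_iff)
qed

text \<open>The chain rule turns (1 + t) f' = x f for f = (1 + t)^x into g' = x g for the composite
  g, whose constant term is 1.\<close>

lemma fps_binomial_compose_exp:
  "fps_compose (fps_binomial x) (fps_exp 1 - 1) = fps_exp (x :: 'a::field_char_0)"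
proof -
  let ?E = "fps_exp 1 - 1 :: 'a fps"
  have E0: "fps_nth ?E 0 = 0"
    by simp
  have "fps_deriv (fps_binomial x) * (1 + fps_X) = fps_const x * fps_binomial x"
    by (simp add: fps_binomial_deriv fps_divide_unit mult.assoc inverse_mult_eq_1)
  then have "fps_compose (fps_deriv (fps_binomial x) * (1 + fps_X)) ?E =
      fps_compose (fps_const x * fps_binomial x) ?E"
    by simp
  then have "fps_compose (fps_deriv (fps_binomial x)) ?E * fps_exp 1 =
      fps_const x * fps_compose (fps_binomial x) ?E"
    by (simp add: fps_compose_mult_distrib[OF E0] fps_compose_add_distrib)
  then have "fps_deriv (fps_compose (fps_binomial x) ?E) =
      fps_const x * fps_compose (fps_binomial x) ?E"
    by (simp add: fps_compose_deriv[OF E0])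
  then show ?thesis
    by (simp add: fps_exp_unique_ODE)
qed

text \<open>The series log(1 + t) is the compositional inverse of e^u - 1, so t times
  \<open>daehee_fps\<close> becomes u; cancelling e^u - 1 leaves the claim.\<close>

lemma daehee_fps_compose_exp:
  "fps_compose daehee_fps (fps_exp 1 - 1) = (fps_X / (fps_exp 1 - 1) :: 'a::field_char_0 fps)"
proof -
  let ?E = "fps_exp 1 - 1 :: 'a fps"
  have E0: "fps_nth ?E 0 = 0" and nz: "?E \<noteq> 0"
    by simp_all
  have "fps_compose (fps_inv ?E) ?E = fps_X"
    by (intro fps_inv) auto
  then have "fps_compose (fps_X * daehee_fps) ?E = fps_X"
    by (simp add: fps_X_mult_daehee_fps fps_ln_fps_exp_inv)
  then have "?E * fps_compose daehee_fps ?E = ?E * (fps_X / ?E)"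
    by (simp only: fps_compose_mult_distrib[OF E0] fps_X_fps_compose_startby0[OF E0] fps_exp_minus_1_mult)
  then show ?thesis
    using mult_left_cancel[OF nz] by blast
qed

text \<open>The order n + k + 1 collects k factors from log(1 + t)/t and n + 1 from the pole
  t^(-n-1); the shift to x + 1 comes from dt = e^u du.\<close>

lemma bernoulli_poly_eq_coeff:
  "bernoulli_poly (n + k + 1) n (x + 1 :: 'a::field_char_0) =
    fact n * fps_nth (daehee_fps ^ k * fps_binomial x) n"
proof -
  let ?E = "fps_exp 1 - 1 :: 'a fps"
  have E0: "fps_nth ?E 0 = 0"
    by simp
  have "fps_compose (daehee_fps ^ k * fps_binomial x) ?E * (fps_deriv ?E * (fps_X / ?E) ^ Suc n) =
      (fps_X / ?E) ^ k * fps_exp x * (fps_exp 1 * (fps_X / ?E) ^ Suc n)"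
    by (simp add: fps_compose_mult_distrib[OF E0] daehee_fps_compose_exp fps_binomial_compose_exp
        flip: fps_compose_power[OF E0])
  also have "\<dots> = (fps_X / ?E) ^ (n + k + 1) * fps_exp (x + 1)"
    by (simp add: fps_exp_add_mult power_add mult_ac)
  finally have eq: "fps_compose (daehee_fps ^ k * fps_binomial x) ?E * (fps_deriv ?E * (fps_X / ?E) ^ Suc n) =
      (fps_X / ?E) ^ (n + k + 1) * fps_exp (x + 1)" .
  show ?thesis
    using fps_nth_change_of_variable[OF fps_exp_minus_1_mult E0, of "daehee_fps ^ k * fps_binomial x" n]
    by (simp only: bernoulli_poly_def eq)
qed

lemma bernoulli_poly_expansion:
  "bernoulli_poly \<alpha> n (z :: 'a::field_char_0) =
    (\<Sum>l=0..n. of_nat (n choose l) * bernoulli_num \<alpha> l * z ^ (n - l))"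
proof -
  have "bernoulli_num \<alpha> l = fact l * fps_nth ((fps_X / (fps_exp 1 - 1 :: 'a fps)) ^ \<alpha>) l" for l
    by (simp add: bernoulli_num_def bernoulli_poly_def)
  then show ?thesis
    unfolding bernoulli_poly_def fps_mult_nth sum_distrib_left
    by (intro sum.cong) (auto simp: binomial_fact field_simps)
qed

theorem theorem6:
  fixes p n k :: nat and x :: "'a::{field_char_0,complete_space}"
  assumes "prime p" and "is_C_p p TYPE('a)" and "k \<ge> 1"
  shows "daehee_poly p k n x = bernoulli_poly (n + k + 1) n (x + 1) \<and>
         bernoulli_poly (n + k + 1) n (x + 1) =
           (\<Sum>l=0..n. of_nat (n choose l) * bernoulli_num (n + k + 1) l * (x + 1) ^ (n - l))"
proof -
  interpret padic_complex_field p "TYPE('a)"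
    using assms by unfold_locales
  show ?thesis
    using daehee_poly_eq_coeff[of k n x] bernoulli_poly_eq_coeff[of n k x]
      bernoulli_poly_expansion[of "n + k + 1" n "x + 1"] by simp
qed

end
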